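(* For every $\rho>0$, every $\delta\in(0,1)$, every $\Delta_0\in\mathbb{N}$, every number of iterations $I\in\mathbb{N}$, $I\ge1$, and every ratio $r>0$, the DP-SIPS mechanism with these parameters satisfies $\delta$-approximate $\rho$-zCDP, where neighboring datasets are those differing by the addition or removal of one user's list.
   Context: Let $\mathcal{U}$ be a (possibly infinite) universe of items. A dataset is a finite sequence $x=(W_1,\dots,W_N)$ of user lists $W_i\in\mathcal{U}^*$. Datasets $x,x'$ are neighbors if one is obtained from the other by adding one user list. Let $\Phi$ be the standard normal CDF and $[\Delta_0]=\{1,\dots,\Delta_0\}$. The Weighted Gaussian mechanism $\mathrm{WG}_{\rho,\delta,\Delta_0}(x)$: (1) For each user $i$, remove duplicates from $W_i$, and let $\overline W_i$ be a uniformly random subset of at most $\Delta_0$ of its distinct items (all of them if at most $\Delta_0$). (2) Set $H[u]=\sum_{i:\,u\in\overline W_i}1/\sqrt{|\overline W_i|}$ for $u\in\bigcup_i\overline W_i$. (3) Set $\sigma=1/\sqrt{2\rho}$ and $T=\max_{k\in[\Delta_0]}\{1/\sqrt{k}+\sigma\Phi^{-1}((1-\delta)^{1/k})\}$. (4) For each $u$ in the support of $H$ independently draw $Z_u\sim\mathcal{N}(0,1/(2\rho))$; output $\{u:H[u]+Z_u\ge T\}$. DP-SIPS with parameters $(\rho,\delta,\Delta_0,I,r)$: start with $S=\emptyset$. For $i=0,\dots,I-1$: if $r=1$ set $(\rho_i,\delta_i)=(\rho/I,\delta/I)$; otherwise set $\rho_i=\rho\, r^{I-i-1}\frac{1-r}{1-r^I}$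 and $\delta_i=\delta\, r^{I-i-1}\frac{1-r}{1-r^I}$. Compute $P_i=\mathrm{WG}_{\rho_i,\delta_i,\Delta_0}(W_1,\dots,W_N)$ on the current lists (fresh randomness), then replace each $W_j$ by $W_j\setminus P_i$ (remove all occurrences of released items) and set $S\leftarrow S\cup P_i$. Output $S$. For distributions $P,Q$ and $\alpha\in(1,\infty)$, $D_\alpha(P\|Q)=\frac{1}{\alpha-1}\log\bigl(\sum_s P(s)^\alpha Q(s)^{1-\alpha}\bigr)$. A mechanism $\mathcal{M}$ satisfies $\delta$-approximate $\rho$-zCDP if for all neighboring $x,x'$ there exist events $E$ (depending on $\mathcal{M}(x)$) and $E'$ (depending on $\mathcal{M}(x')$) with $\Pr[E]\ge1-\delta$, $\Pr[E']\ge1-\delta$, such that for all $\alpha\in(1,\infty)$, $D_\alpha(\mathcal{M}(x)|_E\|\mathcal{M}(x')|_{E'})\le\rho\alpha$ and $D_\alpha(\mathcal{M}(x')|_{E'}\|\mathcal{M}(x)|_{E})\le\rho\alpha$, where $|_E$ denotes conditioning on $E$. *)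

theory Defs
  imports "HOL-Probability.Probability"
begin

definition Phi :: "real \<Rightarrow> real" where
  "Phi x = measure (density lborel std_normal_density) {..x}"

definition Phi_inv :: "real \<Rightarrow> real" where
  "Phi_inv p = (THE x. Phi x = p)"

definition sample_user :: "nat \<Rightarrow> 'a list \<Rightarrow> 'a set pmf" where
  "sample_user D0 W = pmf_of_set {S. S \<subseteq> set W \<and> card S = min D0 (card (set W))}"

definition WG_hist :: "nat \<Rightarrow> (nat \<Rightarrow> 'a set) \<Rightarrow> 'a \<Rightarrow> real" where
  "WG_hist N Wb u = (\<Sum>i\<in>{i. i < N \<and> u \<in> Wb i}. 1 / sqrt (real (card (Wb i))))"

definition WG_sigma :: "real \<Rightarrow> real" where
  "WG_sigma \<rho> = 1 / sqrt (2 * \<rho>)"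

definition WG_threshold :: "real \<Rightarrow> real \<Rightarrow> nat \<Rightarrow> real" where
  "WG_threshold \<rho> \<delta> D0 =
     Max ((\<lambda>k::nat. 1 / sqrt (real k) + WG_sigma \<rho> * Phi_inv ((1 - \<delta>) powr (1 / real k))) ` {1..D0})"

definition WG_release_prob :: "real \<Rightarrow> real \<Rightarrow> real \<Rightarrow> real" where
  "WG_release_prob \<rho> T h =
     measure (density lborel (normal_density 0 (WG_sigma \<rho>))) {z. h + z \<ge> T}"

definition WG :: "real \<Rightarrow> real \<Rightarrow> nat \<Rightarrow> 'a list list \<Rightarrow> 'a set pmf" where
  "WG \<rho> \<delta> D0 x =
     do {
       Wb \<leftarrow> Pi_pmf {..<length x} {} (\<lambda>i. sample_user D0 (x ! i));
       let supp = (\<Union>i<length x. Wb i);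
       let H = WG_hist (length x) Wb;
       let T = WG_threshold \<rho> \<delta> D0;
       b \<leftarrow> Pi_pmf supp False (\<lambda>u. bernoulli_pmf (WG_release_prob \<rho> T (H u)));
       return_pmf {u \<in> supp. b u}
     }"

definition sips_budget :: "real \<Rightarrow> real \<Rightarrow> nat \<Rightarrow> real \<Rightarrow> nat \<Rightarrow> real \<times> real" where
  "sips_budget \<rho> \<delta> I r i =
     (if r = 1 then (\<rho> / real I, \<delta> / real I)
      else (\<rho> * r ^ (I - i - 1) * (1 - r) / (1 - r ^ I),
            \<delta> * r ^ (I - i - 1) * (1 - r) / (1 - r ^ I)))"

primrec sips_run :: "nat \<Rightarrow> (real \<times> real) list \<Rightarrow> 'a list list \<Rightarrow> 'a set \<Rightarrow> 'a set pmf" where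
  "sips_run D0 [] x S = return_pmf S"
| "sips_run D0 (b # bs) x S =
     do {
       P \<leftarrow> WG (fst b) (snd b) D0 x;
       sips_run D0 bs (map (filter (\<lambda>u. u \<notin> P)) x) (S \<union> P)
     }"

definition DP_SIPS :: "real \<Rightarrow> real \<Rightarrow> nat \<Rightarrow> nat \<Rightarrow> real \<Rightarrow> 'a list list \<Rightarrow> 'a set pmf" where
  "DP_SIPS \<rho> \<delta> D0 I r x = sips_run D0 (map (sips_budget \<rho> \<delta> I r) [0..<I]) x {}"

definition neighbors :: "'a list list \<Rightarrow> 'a list list \<Rightarrow> bool" where
  "neighbors x x' \<longleftrightarrow> (\<exists>k W. k \<le> length x \<and> x' = take k x @ [W] @ drop k x)"

definition renyi_div :: "real \<Rightarrow> 'b pmf \<Rightarrow> 'b pmf \<Rightarrow> ereal" where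
  "renyi_div \<alpha> P Q =
     (if \<exists>s\<in>set_pmf P. pmf Q s = 0 then \<infinity>
      else (let Z = (\<integral>\<^sup>+ s. ennreal (pmf P s powr \<alpha> * pmf Q s powr (1 - \<alpha>)) \<partial>count_space UNIV)
            in if Z = \<infinity> then \<infinity> else ereal (ln (enn2real Z) / (\<alpha> - 1))))"

text \<open>An event E "depending on M(x)" is represented by a joint distribution J of
  (indicator of E, output) whose output marginal is M(x); M(x)|_E is the output
  distribution conditioned on the indicator being True.\<close>
definition event_of :: "('b) pmf \<Rightarrow> (bool \<times> 'b) pmf \<Rightarrow> real \<Rightarrow> bool" where
  "event_of M J \<delta> \<longleftrightarrow> map_pmf snd J = M \<and> measure_pmf.prob J {p. fst p} \<ge> 1 - \<delta>"

definition cond_event :: "(bool \<times> 'b) pmf \<Rightarrow> 'b pmf" where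
  "cond_event J = map_pmf snd (cond_pmf J {p. fst p})"

definition approx_zCDP :: "real \<Rightarrow> real \<Rightarrow> ('a list list \<Rightarrow> 'b pmf) \<Rightarrow> bool" where
  "approx_zCDP \<rho> \<delta> M \<longleftrightarrow>
     (\<forall>x x'. neighbors x x' \<longrightarrow>
        (\<exists>J J'. event_of (M x) J \<delta> \<and> event_of (M x') J' \<delta> \<and>
           (\<forall>\<alpha>>1. renyi_div \<alpha> (cond_event J) (cond_event J') \<le> ereal (\<rho> * \<alpha>) \<and>
                   renyi_div \<alpha> (cond_event J') (cond_event J) \<le> ereal (\<rho> * \<alpha>))))"

end

theory Submission
  imports Defs
begin

text \<open>Sample the same subsets for the users common to both datasets and let \<open>V\<close>, with
  \<open>k = |V|\<close>, be the subset drawn for the additional user. On the items already supported by the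
  smaller dataset, releasing an item is a threshold test on a Gaussian whose mean moves by \<open>1/\<surd>k\<close>
  for at most \<open>k\<close> items, so data processing bounds the Renyi divergence by \<open>\<rho> \<alpha>\<close>. The items of
  \<open>V\<close> outside this support are all withheld with probability at least \<open>1 - \<delta>\<close> by the choice of
  the threshold. The probability of this event depends on the sample, so conditioning on it would
  reweight the samples; instead one keeps a randomly thinned event of conditional probability
  exactly \<open>1 - \<delta>\<close>, after which the bounds can be mixed over the samples and composed
  adaptively over the iterations.\<close>

section \<open>Power means\<close>

text \<open>\<open>x powr \<alpha> * y powr (1 - \<alpha>)\<close> is the perspective of a convex
  power, and the left side is its tangent plane along the ray \<open>x = c * y\<close>. Scaling to
  \<open>t = x / (c * y)\<close> reduces the bound to Bernoulli's inequality, obtained from Young's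
  inequality with second factor 1.\<close>

lemma powr_perspective_tangent:
  fixes x y c \<alpha> :: real
  assumes "\<alpha> > 1" "x > 0" "y > 0" "c > 0"
  shows "\<alpha> * c powr (\<alpha> - 1) * x - (\<alpha> - 1) * c powr \<alpha> * y \<le> x powr \<alpha> * y powr (1 - \<alpha>)"
proof -
  define t where "t = x / (c * y)"
  have t: "t > 0" using assms by (simp add: t_def)
  have "(t powr \<alpha>) powr (1/\<alpha>) * 1 powr (1 - 1/\<alpha>) \<le> (1/\<alpha>) * t powr \<alpha> + (1 - 1/\<alpha>) * 1"
    using assms t by (intro Youngs_inequality_0) auto
  then have "t \<le> t powr \<alpha> / \<alpha> + 1 - 1/\<alpha>"
    using assms t by (simp add: powr_powr)
  then have "\<alpha> * t \<le> \<alpha> * (t powr \<alpha> / \<alpha> + 1 - 1/\<alpha>)"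
    using assms by (intro mult_left_mono) auto
  also have "\<dots> = t powr \<alpha> + \<alpha> - 1"
    using assms by (simp add: field_simps)
  finally have bern: "\<alpha> * t - (\<alpha> - 1) \<le> t powr \<alpha>" by simp
  have "(c powr \<alpha> * y) * (\<alpha> * t - (\<alpha> - 1)) \<le> (c powr \<alpha> * y) * t powr \<alpha>"
    using assms by (intro mult_left_mono bern) auto
  moreover have "(c powr \<alpha> * y) * t powr \<alpha> = x powr \<alpha> * y powr (1 - \<alpha>)"
    using assms by (simp add: t_def powr_divide powr_mult powr_diff)
  moreover have "c powr \<alpha> * y * t = c powr (\<alpha> - 1) * x"
    using assms by (simp add: t_def powr_diff)
  then have "(c powr \<alpha> * y) * (\<alpha> * t - (\<alpha> - 1))
      = \<alpha> * c powr (\<alpha> - 1) * x - (\<alpha> - 1) * c powr \<alpha> * y"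
    by (simp add: algebra_simps)
  ultimately show ?thesis by simp
qed

text \<open>At \<open>c = x / y\<close> the tangent plane touches, so an expression in totals can be
  linearised at the ratio of those totals.\<close>

lemma powr_perspective_tangent_eq:
  fixes x y \<alpha> :: real
  assumes "x > 0" "y > 0"
  shows "\<alpha> * (x / y) powr (\<alpha> - 1) * x - (\<alpha> - 1) * (x / y) powr \<alpha> * y = x powr \<alpha> * y powr (1 - \<alpha>)"
  using assms by (simp add: powr_divide powr_diff field_simps)

text \<open>Joint convexity in homogeneous form: take the tangent plane at the ratio of the two
  totals, where it is exact, and compare term by term. \<open>zero\<close> excludes a positive
  \<open>x i\<close> over a vanishing \<open>y i\<close>, where
  \<open>0 powr (1 - \<alpha>) = 0\<close> would hide an infinite term.\<close>

lemma powr_perspective_sum_le: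
  fixes x y :: "'i \<Rightarrow> real"
  assumes "\<alpha> > 1" "finite I"
    and nn: "\<And>i. i \<in> I \<Longrightarrow> x i \<ge> 0" "\<And>i. i \<in> I \<Longrightarrow> y i \<ge> 0"
    and zero: "\<And>i. i \<in> I \<Longrightarrow> x i = 0 \<longleftrightarrow> y i = 0"
  shows "(\<Sum>i\<in>I. x i) powr \<alpha> * (\<Sum>i\<in>I. y i) powr (1 - \<alpha>) \<le> (\<Sum>i\<in>I. x i powr \<alpha> * y i powr (1 - \<alpha>))"
proof (cases "(\<Sum>i\<in>I. x i) = 0")
  case True
  then show ?thesis by (auto intro!: sum_nonneg)
next
  case False
  let ?X = "\<Sum>i\<in>I. x i" and ?Y = "\<Sum>i\<in>I. y i"
  have X: "?X > 0"
    using False sum_nonneg[of I x] nn by (auto simp: less_le)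
  have "?Y \<noteq> 0"
    using False zero nn assms(2) by (auto simp: sum_nonneg_eq_0_iff)
  then have Y: "?Y > 0"
    using sum_nonneg[of I y] nn by (auto simp: less_le)
  define c where "c = ?X / ?Y"
  have c: "c > 0" using X Y by (simp add: c_def)
  have "?X powr \<alpha> * ?Y powr (1 - \<alpha>) = \<alpha> * c powr (\<alpha> - 1) * ?X - (\<alpha> - 1) * c powr \<alpha> * ?Y"
    unfolding c_def by (rule powr_perspective_tangent_eq[symmetric, OF X Y])
  also have "\<dots> = (\<Sum>i\<in>I. \<alpha> * c powr (\<alpha> - 1) * x i - (\<alpha> - 1) * c powr \<alpha> * y i)"
    by (simp add: sum_subtractf sum_distrib_left)
  also have "\<dots> \<le> (\<Sum>i\<in>I. x i powr \<alpha> * y i powr (1 - \<alpha>))"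
  proof (rule sum_mono)
    fix i assume i: "i \<in> I"
    show "\<alpha> * c powr (\<alpha> - 1) * x i - (\<alpha> - 1) * c powr \<alpha> * y i \<le> x i powr \<alpha> * y i powr (1 - \<alpha>)"
    proof (cases "x i = 0")
      case True
      then show ?thesis using zero[OF i] by simp
    next
      case False
      then have "x i > 0" "y i > 0" using i nn[OF i] zero[OF i] by auto
      then show ?thesis using powr_perspective_tangent assms(1) c by blast
    qed
  qed
  finally show ?thesis .
qed

section \<open>Renyi bounds on finitely supported distributions\<close>

text \<open>The divergence bound \<open>\<rho> * \<alpha>\<close> in exponentiated form, for all
  orders at once: moment sums multiply under composition, so the exponents add. Equal supports keep
  the divergence finite, and finiteness makes it a plain sum.\<close>

definition renyi_bounded :: "real \<Rightarrow> 'b pmf \<Rightarrow> 'b pmf \<Rightarrow> bool" where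
  "renyi_bounded \<rho> P Q \<longleftrightarrow> finite (set_pmf Q) \<and> set_pmf P = set_pmf Q \<and>
     (\<forall>\<alpha>>1. (\<Sum>s\<in>set_pmf Q. pmf P s powr \<alpha> * pmf Q s powr (1 - \<alpha>)) \<le> exp (\<alpha> * (\<alpha> - 1) * \<rho>))"

lemma renyi_bounded_refl:
  assumes "finite (set_pmf P)" "\<rho> \<ge> 0"
  shows "renyi_bounded \<rho> P P"
proof -
  have "(\<Sum>s\<in>set_pmf P. pmf P s powr \<alpha> * pmf P s powr (1 - \<alpha>)) \<le> exp (\<alpha> * (\<alpha> - 1) * \<rho>)"
    if "\<alpha> > 1" for \<alpha>
  proof -
    have "(\<Sum>s\<in>set_pmf P. pmf P s powr \<alpha> * pmf P s powr (1 - \<alpha>)) = (\<Sum>s\<in>set_pmf P. pmf P s)"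
      by (intro sum.cong) (auto simp: powr_add[symmetric])
    also have "\<dots> = 1" using assms by (intro sum_pmf_eq_1) auto
    also have "\<dots> \<le> exp (\<alpha> * (\<alpha> - 1) * \<rho>)"
      using that assms by simp
    finally show ?thesis .
  qed
  then show ?thesis using assms by (auto simp: renyi_bounded_def)
qed

lemma renyi_bounded_mono:
  assumes "renyi_bounded \<rho> P Q" "\<rho> \<le> \<rho>'"
  shows "renyi_bounded \<rho>' P Q"
proof -
  have "exp (\<alpha> * (\<alpha> - 1) * \<rho>) \<le> exp (\<alpha> * (\<alpha> - 1) * \<rho>')" if "\<alpha> > 1" for \<alpha>
    using that assms by (simp add: mult_left_mono)
  then show ?thesis using assms unfolding renyi_bounded_def by (meson order_trans)
qed

section \<open>Composition, images and products of Renyi bounds\<close>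

lemma pmf_bind_finite:
  assumes "finite (set_pmf P)"
  shows "pmf (bind_pmf P F) s = (\<Sum>p\<in>set_pmf P. pmf P p * pmf (F p) s)"
  by (simp add: pmf_bind integral_measure_pmf_real[OF assms] mult.commute)

text \<open>For the pair of intermediate value and output, the moment sum is at most the product of
  the two bounds; keeping only the output can only decrease it.\<close>

lemma renyi_bounded_bind:
  assumes PQ: "renyi_bounded \<rho>1 P Q"
    and FG: "\<And>p. p \<in> set_pmf P \<Longrightarrow> renyi_bounded \<rho>2 (F p) (G p)"
  shows "renyi_bounded (\<rho>1 + \<rho>2) (bind_pmf P F) (bind_pmf Q G)"
proof -
  let ?A = "set_pmf Q" and ?S = "set_pmf (bind_pmf Q G)"
  have finA: "finite ?A" and setP: "set_pmf P = ?A"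
    using PQ by (auto simp: renyi_bounded_def)
  have finG: "finite (set_pmf (G p))" and setF: "set_pmf (F p) = set_pmf (G p)" if "p \<in> ?A" for p
    using FG[of p] that setP by (auto simp: renyi_bounded_def)
  have finS: "finite ?S" using finA finG by simp
  have "(\<Sum>s\<in>?S. pmf (bind_pmf P F) s powr \<alpha> * pmf (bind_pmf Q G) s powr (1 - \<alpha>))
          \<le> exp (\<alpha> * (\<alpha> - 1) * (\<rho>1 + \<rho>2))" if \<alpha>: "\<alpha> > 1" for \<alpha>
  proof -
    have "(\<Sum>s\<in>?S. pmf (bind_pmf P F) s powr \<alpha> * pmf (bind_pmf Q G) s powr (1 - \<alpha>))
      = (\<Sum>s\<in>?S. (\<Sum>p\<in>?A. pmf P p * pmf (F p) s) powr \<alpha> * (\<Sum>p\<in>?A. pmf Q p * pmf (G p) s) powr (1 - \<alpha>))"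
      using finA setP by (simp add: pmf_bind_finite)
    \<comment> \<open>Data processing: forgetting the intermediate value \<open>p\<close> is the
      power mean inequality, applied for each output \<open>s\<close>.\<close>
    also have "\<dots> \<le> (\<Sum>s\<in>?S. \<Sum>p\<in>?A. (pmf P p * pmf (F p) s) powr \<alpha> * (pmf Q p * pmf (G p) s) powr (1 - \<alpha>))"
    proof (intro sum_mono powr_perspective_sum_le)
      fix s p assume "p \<in> ?A"
      then show "(pmf P p * pmf (F p) s = 0) = (pmf Q p * pmf (G p) s = 0)"
        using setP setF[of p] by (simp add: pmf_eq_0_set_pmf)
    qed (use \<alpha> finA in auto)
    also have "\<dots> = (\<Sum>p\<in>?A. pmf P p powr \<alpha> * pmf Q p powr (1 - \<alpha>) *
                      (\<Sum>s\<in>?S. pmf (F p) s powr \<alpha> * pmf (G p) s powr (1 - \<alpha>)))"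
      by (subst sum.swap) (simp add: powr_mult sum_distrib_left mult_ac)
    also have "\<dots> \<le> (\<Sum>p\<in>?A. pmf P p powr \<alpha> * pmf Q p powr (1 - \<alpha>) * exp (\<alpha> * (\<alpha> - 1) * \<rho>2))"
    proof (intro sum_mono mult_left_mono)
      fix p assume p: "p \<in> ?A"
      have "(\<Sum>s\<in>?S. pmf (F p) s powr \<alpha> * pmf (G p) s powr (1 - \<alpha>))
          = (\<Sum>s\<in>set_pmf (G p). pmf (F p) s powr \<alpha> * pmf (G p) s powr (1 - \<alpha>))"
        using finS p by (intro sum.mono_neutral_right) (auto simp: pmf_eq_0_set_pmf)
      also have "\<dots> \<le> exp (\<alpha> * (\<alpha> - 1) * \<rho>2)"
        using FG[of p] p setP \<alpha> by (auto simp: renyi_bounded_def)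
      finally show "(\<Sum>s\<in>?S. pmf (F p) s powr \<alpha> * pmf (G p) s powr (1 - \<alpha>)) \<le> exp (\<alpha> * (\<alpha> - 1) * \<rho>2)" .
    qed auto
    also have "\<dots> = (\<Sum>p\<in>?A. pmf P p powr \<alpha> * pmf Q p powr (1 - \<alpha>)) * exp (\<alpha> * (\<alpha> - 1) * \<rho>2)"
      by (simp add: sum_distrib_right)
    also have "\<dots> \<le> exp (\<alpha> * (\<alpha> - 1) * \<rho>1) * exp (\<alpha> * (\<alpha> - 1) * \<rho>2)"
      using PQ \<alpha> by (intro mult_right_mono) (auto simp: renyi_bounded_def)
    also have "\<dots> = exp (\<alpha> * (\<alpha> - 1) * (\<rho>1 + \<rho>2))"
      by (simp add: exp_add[symmetric] distrib_left)
    finally show ?thesis .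
  qed
  then show ?thesis
    using finS setF setP unfolding renyi_bounded_def by auto
qed

text \<open>Post-processing is composition with point masses, which cost 0.\<close>

lemma renyi_bounded_map:
  assumes "renyi_bounded \<rho> P Q"
  shows "renyi_bounded \<rho> (map_pmf f P) (map_pmf f Q)"
  using renyi_bounded_bind[OF assms, of 0 "\<lambda>x. return_pmf (f x)" "\<lambda>x. return_pmf (f x)"]
  by (simp add: map_pmf_def renyi_bounded_refl)

text \<open>Drawing one coordinate first and inserting it into the others makes an independent
  product an instance of composition.\<close>

lemma renyi_bounded_Pi_pmf:
  assumes "finite A" "\<And>u. u \<in> A \<Longrightarrow> renyi_bounded (\<rho> u) (p u) (q u)"
  shows "renyi_bounded (\<Sum>u\<in>A. \<rho> u) (Pi_pmf A d p) (Pi_pmf A d q)"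
  using assms
proof (induction A rule: finite_induct)
  case empty
  then show ?case by (simp add: renyi_bounded_refl)
next
  case (insert u A)
  have "renyi_bounded (\<rho> u + (\<Sum>u\<in>A. \<rho> u))
     (p u \<bind> (\<lambda>y. map_pmf (\<lambda>f. f(u := y)) (Pi_pmf A d p)))
     (q u \<bind> (\<lambda>y. map_pmf (\<lambda>f. f(u := y)) (Pi_pmf A d q)))"
    using insert by (intro renyi_bounded_bind renyi_bounded_map) auto
  then show ?case using insert by (simp add: Pi_pmf_insert' map_pmf_def)
qed

lemma renyi_div_le:
  assumes "renyi_bounded \<rho> P Q" "\<rho> \<ge> 0" "\<alpha> > 1"
  shows "renyi_div \<alpha> P Q \<le> ereal (\<rho> * \<alpha>)"
proof -
  let ?Z = "\<Sum>s\<in>set_pmf Q. pmf P s powr \<alpha> * pmf Q s powr (1 - \<alpha>)"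
  have fin: "finite (set_pmf Q)" and set: "set_pmf P = set_pmf Q" and Z: "?Z \<le> exp (\<alpha> * (\<alpha> - 1) * \<rho>)"
    using assms by (auto simp: renyi_bounded_def)
  have Z0: "?Z \<ge> 0" by (intro sum_nonneg) auto
  have "(\<integral>\<^sup>+ s. ennreal (pmf P s powr \<alpha> * pmf Q s powr (1 - \<alpha>)) \<partial>count_space UNIV)
      = (\<Sum>s\<in>set_pmf Q. ennreal (pmf P s powr \<alpha> * pmf Q s powr (1 - \<alpha>)))"
    by (rule nn_integral_count_space'[OF fin]) (auto simp: pmf_eq_0_set_pmf)
  also have "\<dots> = ennreal ?Z" by (simp add: sum_ennreal)
  finally have int: "(\<integral>\<^sup>+ s. ennreal (pmf P s powr \<alpha> * pmf Q s powr (1 - \<alpha>)) \<partial>count_space UNIV) = ennreal ?Z" .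
  have "ln ?Z \<le> \<alpha> * (\<alpha> - 1) * \<rho>"
  proof (cases "?Z = 0")
    \<comment> \<open>The convention \<open>ln 0 = 0\<close> keeps the bound valid here, as the
      right side is nonnegative.\<close>
    case True
    then show ?thesis using assms by (simp only: ln_0) simp
  next
    case False
    then have "?Z > 0" using Z0 by linarith
    then show ?thesis using Z by (metis ln_exp ln_le_cancel_iff exp_gt_zero)
  qed
  then have "ln ?Z / (\<alpha> - 1) \<le> \<rho> * \<alpha>"
    using assms by (simp add: field_simps)
  then show ?thesis
    using int set Z0 unfolding renyi_div_def by (auto simp: Let_def pmf_eq_0_set_pmf)
qed

section \<open>Approximate closeness\<close>

text \<open>A distribution \<open>M\<close> carries an event of probability \<open>1 - \<delta>\<close> on which its law is \<open>A\<close>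
  if and only if \<open>A\<close> scaled by \<open>1 - \<delta>\<close> is pointwise below \<open>M\<close>.\<close>

definition dominated :: "real \<Rightarrow> 'b pmf \<Rightarrow> 'b pmf \<Rightarrow> bool" where
  "dominated \<delta> A M \<longleftrightarrow> (\<forall>s. (1 - \<delta>) * pmf A s \<le> pmf M s)"

text \<open>\<open>A\<close> and \<open>A'\<close> stand for the two outputs conditioned on their
  events. With domination in place of events, composition only involves inequalities between
  masses.\<close>

definition approx_close :: "real \<Rightarrow> real \<Rightarrow> 'b pmf \<Rightarrow> 'b pmf \<Rightarrow> bool" where
  "approx_close \<rho> \<delta> M M' \<longleftrightarrow>
     (\<exists>A A'. dominated \<delta> A M \<and> dominated \<delta> A' M' \<and> renyi_bounded \<rho> A A' \<and> renyi_bounded \<rho> A' A)"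

lemma dominated_refl: "\<delta> \<ge> 0 \<Longrightarrow> dominated \<delta> M M"
  by (simp add: dominated_def left_diff_distrib)

lemma dominated_set_pmf:
  assumes "dominated \<delta> A M" "\<delta> < 1"
  shows "set_pmf A \<subseteq> set_pmf M"
proof
  fix s assume "s \<in> set_pmf A"
  then have "0 < (1 - \<delta>) * pmf A s" using assms by (simp add: pmf_positive)
  also have "\<dots> \<le> pmf M s" using assms by (simp add: dominated_def)
  finally show "s \<in> set_pmf M" by (simp add: set_pmf_iff)
qed

text \<open>The retained fractions multiply, and \<open>(1 - \<delta>1) * (1 - \<delta>2)\<close> is
  at least \<open>1 - (\<delta>1 + \<delta>2)\<close>. Nonnegative integrals over the intermediate
  value cover infinite supports.\<close>

lemma dominated_bind:
  assumes AM: "dominated \<delta>1 A M" and \<delta>: "0 \<le> \<delta>1" "\<delta>1 \<le> 1" "0 \<le> \<delta>2" "\<delta>2 \<le> 1"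
    and BN: "\<And>p. p \<in> set_pmf A \<Longrightarrow> dominated \<delta>2 (B p) (N p)"
  shows "dominated (\<delta>1 + \<delta>2) (bind_pmf A B) (bind_pmf M N)"
  unfolding dominated_def
proof
  fix s
  have "ennreal ((1 - \<delta>1) * (1 - \<delta>2) * pmf (bind_pmf A B) s)
      = ennreal ((1 - \<delta>1) * (1 - \<delta>2)) * (\<integral>\<^sup>+p. ennreal (pmf A p) * ennreal (pmf (B p) s) \<partial>count_space UNIV)"
    using \<delta> by (simp add: ennreal_mult ennreal_pmf_bind nn_integral_measure_pmf)
  also have "\<dots> = (\<integral>\<^sup>+p. ennreal (((1 - \<delta>1) * pmf A p) * ((1 - \<delta>2) * pmf (B p) s)) \<partial>count_space UNIV)"
    using \<delta> by (simp add: nn_integral_cmult[symmetric] ennreal_mult[symmetric] mult_ac)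
  also have "\<dots> \<le> (\<integral>\<^sup>+p. ennreal (pmf M p * pmf (N p) s) \<partial>count_space UNIV)"
  proof (intro nn_integral_mono ennreal_leI)
    fix p
    show "((1 - \<delta>1) * pmf A p) * ((1 - \<delta>2) * pmf (B p) s) \<le> pmf M p * pmf (N p) s"
    proof (cases "p \<in> set_pmf A")
      case True
      then show ?thesis
        using AM BN[OF True] \<delta> by (intro mult_mono) (auto simp: dominated_def)
    qed (simp add: set_pmf_iff)
  qed
  also have "\<dots> = ennreal (pmf (bind_pmf M N) s)"
    by (simp add: ennreal_mult ennreal_pmf_bind nn_integral_measure_pmf)
  finally have "(1 - \<delta>1) * (1 - \<delta>2) * pmf (bind_pmf A B) s \<le> pmf (bind_pmf M N) s" by simp
  moreover have "1 - (\<delta>1 + \<delta>2) \<le> (1 - \<delta>1) * (1 - \<delta>2)"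
    using \<delta> by (simp add: algebra_simps)
  then have "(1 - (\<delta>1 + \<delta>2)) * pmf (bind_pmf A B) s \<le> (1 - \<delta>1) * (1 - \<delta>2) * pmf (bind_pmf A B) s"
    by (intro mult_right_mono) auto
  ultimately show "(1 - (\<delta>1 + \<delta>2)) * pmf (bind_pmf A B) s \<le> pmf (bind_pmf M N) s" by linarith
qed

text \<open>Adaptive composition: the witnesses of the second stage, chosen for each intermediate
  value, are bound to the witnesses of the first.\<close>

lemma approx_close_bind:
  assumes MM': "approx_close \<rho>1 \<delta>1 M M'" and \<delta>: "0 \<le> \<delta>1" "\<delta>1 < 1" "0 \<le> \<delta>2" "\<delta>2 \<le> 1"
    and NN': "\<And>p. p \<in> set_pmf M \<Longrightarrow> approx_close \<rho>2 \<delta>2 (N p) (N' p)"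
  shows "approx_close (\<rho>1 + \<rho>2) (\<delta>1 + \<delta>2) (bind_pmf M N) (bind_pmf M' N')"
proof -
  obtain A A' where A: "dominated \<delta>1 A M" "dominated \<delta>1 A' M'" "renyi_bounded \<rho>1 A A'" "renyi_bounded \<rho>1 A' A"
    using MM' by (auto simp: approx_close_def)
  have sets: "set_pmf A' = set_pmf A" using A by (simp add: renyi_bounded_def)
  \<comment> \<open>\<open>NN'\<close> speaks only of the support of \<open>M\<close>; since
    \<open>\<delta>1 < 1\<close>, domination places the support of \<open>A\<close> inside
    it.\<close>
  have "\<forall>p\<in>set_pmf A. \<exists>B. dominated \<delta>2 (fst B) (N p) \<and> dominated \<delta>2 (snd B) (N' p) \<and>
           renyi_bounded \<rho>2 (fst B) (snd B) \<and> renyi_bounded \<rho>2 (snd B) (fst B)"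
    using NN' dominated_set_pmf[OF A(1) \<delta>(2)] by (auto simp: approx_close_def subset_iff)
  then obtain B where B: "\<And>p. p \<in> set_pmf A \<Longrightarrow> dominated \<delta>2 (fst (B p)) (N p) \<and> dominated \<delta>2 (snd (B p)) (N' p) \<and>
           renyi_bounded \<rho>2 (fst (B p)) (snd (B p)) \<and> renyi_bounded \<rho>2 (snd (B p)) (fst (B p))"
    by metis
  show ?thesis
    unfolding approx_close_def
    using A B \<delta> sets
    by (intro exI[of _ "bind_pmf A (\<lambda>p. fst (B p))"] exI[of _ "bind_pmf A' (\<lambda>p. snd (B p))"]
          conjI dominated_bind renyi_bounded_bind) auto
qed

lemma approx_close_refl:
  assumes "finite (set_pmf M)" "0 \<le> \<delta>" "0 \<le> \<rho>"
  shows "approx_close \<rho> \<delta> M M"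
  using assms dominated_refl renyi_bounded_refl unfolding approx_close_def by blast

text \<open>Randomness shared by both sides costs nothing: the first stage is close to itself with
  both parameters 0.\<close>

lemma approx_close_bind_same:
  assumes "finite (set_pmf M)" "0 \<le> \<delta>" "\<delta> \<le> 1"
    and "\<And>p. p \<in> set_pmf M \<Longrightarrow> approx_close \<rho> \<delta> (N p) (N' p)"
  shows "approx_close \<rho> \<delta> (bind_pmf M N) (bind_pmf M N')"
  using approx_close_bind[OF approx_close_refl[of M 0 0], of \<delta> \<rho> N N'] assms by simp

text \<open>Rejection sampling: accepting an output \<open>s\<close> with probability
  \<open>q s\<close> leaves mass exactly \<open>(1 - \<delta>) * pmf A s\<close>. The accepted event
  thus has probability \<open>1 - \<delta>\<close> and conditional law \<open>A\<close>.\<close>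

lemma event_of_dominated:
  fixes A M :: "'b pmf"
  assumes dom: "dominated \<delta> A M" and \<delta>: "0 \<le> \<delta>" "\<delta> < 1"
  obtains J where "event_of M J \<delta>" "cond_event J = A"
proof -
  define q where "q s = (1 - \<delta>) * pmf A s / pmf M s" for s
  define J where "J = bind_pmf M (\<lambda>s. map_pmf (\<lambda>b. (b, s)) (bernoulli_pmf (q s)))"
  have le: "(1 - \<delta>) * pmf A s \<le> pmf M s" for s using dom by (simp add: dominated_def)
  have q: "0 \<le> q s" "q s \<le> 1" for s
    using le[of s] \<delta> pmf_nonneg[of M s] unfolding q_def by (auto simp: divide_le_eq_1 less_le)
  have "map_pmf snd J = M"
    by (simp add: J_def map_bind_pmf map_pmf_comp bind_return_pmf')
  have pair: "pmf (map_pmf (\<lambda>b. (b, t)) (bernoulli_pmf (q t))) (True, s) = (if t = s then q s else 0)" for s t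
  proof (cases "t = s")
    case True
    have "pmf (map_pmf (\<lambda>b. (b, s)) (bernoulli_pmf (q s))) ((\<lambda>b. (b, s)) True) = pmf (bernoulli_pmf (q s)) True"
      by (rule pmf_map_inj') (auto simp: inj_def)
    then show ?thesis using True q by simp
  next
    case False
    then show ?thesis by (auto simp: pmf_eq_0_set_pmf)
  qed
  have pJ: "pmf J (True, s) = (1 - \<delta>) * pmf A s" for s
  proof -
    have "pmf J (True, s) = (\<integral>t. (if t = s then q s else 0) \<partial>measure_pmf M)"
      by (simp add: J_def pmf_bind pair)
    also have "\<dots> = (\<Sum>t\<in>{s}. (if t = s then q s else 0) * pmf M t)"
      by (rule integral_measure_pmf_real) (auto split: if_splits)
    also have "\<dots> = q s * pmf M s" by simp
    also have "\<dots> = (1 - \<delta>) * pmf A s"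
    proof (cases "pmf M s = 0")
      case True
      then have "(1 - \<delta>) * pmf A s = 0" using le[of s] \<delta> by (simp add: mult_le_0_iff order_antisym)
      then show ?thesis using True by simp
    qed (simp add: q_def)
    finally show ?thesis .
  qed
  have "emeasure J {p. fst p} = (\<integral>\<^sup>+p. ennreal (pmf J p) * indicator {p. fst p} p \<partial>count_space UNIV)"
    by (simp add: nn_integral_measure_pmf[symmetric])
  also have "\<dots> = (\<integral>\<^sup>+p. ennreal (pmf J p) \<partial>count_space {p. fst p})"
    by (rule nn_integral_count_space_indicator[symmetric, THEN trans]) (auto)
  \<comment> \<open>Outputs \<open>s\<close> correspond one to one to the pairs carrying the flag
    \<open>True\<close>.\<close>
  also have "\<dots> = (\<integral>\<^sup>+s. ennreal (pmf J (True, s)) \<partial>count_space UNIV)"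
    by (rule nn_integral_bij_count_space[symmetric]) (auto simp: bij_betw_def inj_on_def)
  also have "\<dots> = ennreal (1 - \<delta>) * (\<integral>\<^sup>+s. ennreal (pmf A s) \<partial>count_space UNIV)"
    using \<delta> by (simp add: pJ ennreal_mult nn_integral_cmult)
  also have "\<dots> = ennreal (1 - \<delta>)" by (simp add: nn_integral_pmf_eq_1)
  finally have prob: "measure_pmf.prob J {p. fst p} = 1 - \<delta>"
    using \<delta> by (simp add: measure_def)
  have ne: "set_pmf J \<inter> {p. fst p} \<noteq> {}"
    using prob \<delta> by (metis diff_gt_0_iff_gt less_irrefl measure_Int_set_pmf inf_commute measure_empty)
  have "cond_event J = A"
  proof (rule pmf_eqI)
    fix s
    \<comment> \<open>After conditioning the flag is constantly \<open>True\<close>, so dropping it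
      preserves point masses.\<close>
    have inj: "inj_on snd (set_pmf (cond_pmf J {p. fst p}))"
      by (auto simp: set_cond_pmf[OF ne] inj_on_def)
    have cp: "pmf (cond_pmf J {p. fst p}) (True, s) = pmf A s"
      using \<delta> by (simp add: pmf_cond[OF ne] prob pJ)
    show "pmf (cond_event J) s = pmf A s"
    proof (cases "(True, s) \<in> set_pmf (cond_pmf J {p. fst p})")
      case True
      then show ?thesis using pmf_map_inj[OF inj True] cp by (simp add: cond_event_def)
    next
      case False
      then have "s \<notin> set_pmf (cond_event J)"
        by (auto simp: cond_event_def set_cond_pmf[OF ne])
      then show ?thesis using False cp by (simp add: pmf_eq_0_set_pmf[symmetric])
    qed
  qed
  then show thesis
    using that[of J] \<open>map_pmf snd J = M\<close> prob by (simp add: event_of_def)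
qed

lemma approx_zCDP_I:
  assumes "0 \<le> \<rho>" "0 \<le> \<delta>" "\<delta> < 1"
    and "\<And>x x'. neighbors x x' \<Longrightarrow> approx_close \<rho> \<delta> (M x) (M x')"
  shows "approx_zCDP \<rho> \<delta> M"
  unfolding approx_zCDP_def
proof (intro allI impI)
  fix x x' :: "'a list list" assume "neighbors x x'"
  from assms(4)[OF this] obtain A A' where A: "dominated \<delta> A (M x)" "dominated \<delta> A' (M x')"
    "renyi_bounded \<rho> A A'" "renyi_bounded \<rho> A' A"
    by (auto simp: approx_close_def)
  obtain J where "event_of (M x) J \<delta>" "cond_event J = A"
    using event_of_dominated[OF A(1) assms(2,3)] .
  moreover obtain J' where "event_of (M x') J' \<delta>" "cond_event J' = A'"
    using event_of_dominated[OF A(2) assms(2,3)] .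
  ultimately show "\<exists>J J'. event_of (M x) J \<delta> \<and> event_of (M x') J' \<delta> \<and>
           (\<forall>\<alpha>>1. renyi_div \<alpha> (cond_event J) (cond_event J') \<le> ereal (\<rho> * \<alpha>) \<and>
                   renyi_div \<alpha> (cond_event J') (cond_event J) \<le> ereal (\<rho> * \<alpha>))"
    using A renyi_div_le assms(1) by blast
qed

section \<open>Gaussian tails\<close>

abbreviation gauss :: "real \<Rightarrow> real \<Rightarrow> real measure" where
  "gauss \<mu> \<sigma> \<equiv> density lborel (normal_density \<mu> \<sigma>)"

section \<open>Affine images and interval masses\<close>

lemma distr_gauss_affine:
  assumes "\<sigma> > 0" "a \<noteq> 0"
  shows "distr (gauss \<mu> \<sigma>) lborel (\<lambda>z. b + a * z) = gauss (b + a * \<mu>) (\<bar>a\<bar> * \<sigma>)"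
proof -
  interpret prob_space "gauss \<mu> \<sigma>" using assms by (rule_tac prob_space_normal_density)
  have "distr (gauss \<mu> \<sigma>) lborel (\<lambda>z. z) = gauss \<mu> \<sigma>"
    by (rule distr_id2) simp
  then have "distributed (gauss \<mu> \<sigma>) lborel (\<lambda>z. z) (normal_density \<mu> \<sigma>)"
    by (auto simp: distributed_def)
  from normal_density_affine[OF this assms, of b] show ?thesis
    by (simp add: distributed_def)
qed

lemma measure_gauss_affine:
  assumes "\<sigma> > 0" "a \<noteq> 0" "B \<in> sets borel"
  shows "measure (gauss \<mu> \<sigma>) {z. b + a * z \<in> B} = measure (gauss (b + a * \<mu>) (\<bar>a\<bar> * \<sigma>)) B"
  using assms by (subst distr_gauss_affine[symmetric]) (auto simp: measure_distr vimage_def)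

lemma measure_gauss_eq_integral:
  assumes "\<sigma> > 0" "B \<in> sets borel"
  shows "measure (gauss \<mu> \<sigma>) B = (\<integral>z. indicator B z * normal_density \<mu> \<sigma> z \<partial>lborel)"
proof -
  have "measure (gauss \<mu> \<sigma>) B = (\<integral>z. indicator B z \<partial>gauss \<mu> \<sigma>)" by simp
  also have "\<dots> = (\<integral>z. normal_density \<mu> \<sigma> z *\<^sub>R indicator B z \<partial>lborel)"
    using assms by (intro integral_density) auto
  finally show ?thesis by (simp add: mult.commute)
qed

text \<open>The density never vanishes, so a set of mass 0 would be Lebesgue null, although it
  contains an interval.\<close>

lemma measure_gauss_pos:
  assumes "\<sigma> > 0" "a < b" "{a<..<b} \<subseteq> B" "B \<in> sets borel"
  shows "measure (gauss \<mu> \<sigma>) B > 0"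
proof -
  interpret prob_space "gauss \<mu> \<sigma>" using assms by (rule_tac prob_space_normal_density)
  have "measure (gauss \<mu> \<sigma>) B \<noteq> 0"
  proof
    assume "measure (gauss \<mu> \<sigma>) B = 0"
    then have "emeasure (gauss \<mu> \<sigma>) B = 0" by (simp add: emeasure_eq_measure)
    then have "AE z in lborel. z \<in> B \<longrightarrow> ennreal (normal_density \<mu> \<sigma> z) = 0"
      using assms null_sets_density_iff[of "\<lambda>z. ennreal (normal_density \<mu> \<sigma> z)" lborel B]
      by (auto simp: null_sets_def)
    then have "AE z in lborel. z \<notin> {a<..<b}"
    proof (rule eventually_mono)
      fix z assume "z \<in> B \<longrightarrow> ennreal (normal_density \<mu> \<sigma> z) = 0"
      then show "z \<notin> {a<..<b}"
        using assms normal_density_pos[of \<sigma> \<mu> z] by (auto simp: ennreal_eq_0_iff)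
    qed
    then have "emeasure lborel {a<..<b} = 0"
      by (subst (asm) AE_iff_measurable[of "{a<..<b}"]) auto
    then show False using assms by simp
  qed
  then show ?thesis by (simp add: less_le)
qed

text \<open>Completing the square: the weighted product of two Gaussians of equal variance is a
  multiple of a Gaussian with the extrapolated mean. The factor is the exponential of
  \<open>\<alpha> - 1\<close> times their Renyi divergence.\<close>

lemma normal_density_powr_mult:
  assumes "\<sigma> > 0"
  shows "normal_density h \<sigma> z powr \<alpha> * normal_density h' \<sigma> z powr (1 - \<alpha>) =
     exp (\<alpha> * (\<alpha> - 1) * ((h - h')\<^sup>2 / (2 * \<sigma>\<^sup>2))) * normal_density (\<alpha> * h + (1 - \<alpha>) * h') \<sigma> z"
proof -
  define c where "c = 1 / sqrt (2 * pi * \<sigma>\<^sup>2)"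
  have c: "c > 0" using assms by (simp add: c_def)
  have nd: "normal_density m \<sigma> z = c * exp (- ((z - m)\<^sup>2 / (2 * \<sigma>\<^sup>2)))" for m
    by (simp add: normal_density_def c_def)
  have "c powr \<alpha> * c powr (1 - \<alpha>) = c"
    using c by (simp add: powr_add[symmetric])
  moreover have "exp (- ((z - h)\<^sup>2 / (2 * \<sigma>\<^sup>2))) powr \<alpha> * exp (- ((z - h')\<^sup>2 / (2 * \<sigma>\<^sup>2))) powr (1 - \<alpha>)
     = exp (\<alpha> * (\<alpha> - 1) * ((h - h')\<^sup>2 / (2 * \<sigma>\<^sup>2))) * exp (- ((z - (\<alpha> * h + (1 - \<alpha>) * h'))\<^sup>2 / (2 * \<sigma>\<^sup>2)))"
  proof -
    have "\<alpha> * - ((z - h)\<^sup>2 / (2 * \<sigma>\<^sup>2)) + (1 - \<alpha>) * - ((z - h')\<^sup>2 / (2 * \<sigma>\<^sup>2))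
        = (\<alpha> * (\<alpha> - 1) * (h - h')\<^sup>2 - (z - (\<alpha> * h + (1 - \<alpha>) * h'))\<^sup>2) / (2 * \<sigma>\<^sup>2)"
      using assms by (simp add: divide_simps) (simp add: power2_eq_square algebra_simps)
    also have "\<dots> = \<alpha> * (\<alpha> - 1) * ((h - h')\<^sup>2 / (2 * \<sigma>\<^sup>2)) + - ((z - (\<alpha> * h + (1 - \<alpha>) * h'))\<^sup>2 / (2 * \<sigma>\<^sup>2))"
      by (simp add: diff_divide_distrib)
    finally show ?thesis
      by (simp only: powr_def exp_add[symmetric] ln_exp exp_not_eq_zero if_False)
  qed
  moreover have "normal_density h \<sigma> z powr \<alpha> * normal_density h' \<sigma> z powr (1 - \<alpha>) =
      (c powr \<alpha> * c powr (1 - \<alpha>)) *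
      (exp (- ((z - h)\<^sup>2 / (2 * \<sigma>\<^sup>2))) powr \<alpha> * exp (- ((z - h')\<^sup>2 / (2 * \<sigma>\<^sup>2))) powr (1 - \<alpha>))"
    using c by (simp only: nd powr_mult mult_ac)
  ultimately show ?thesis by (simp only: nd mult_ac)
qed

text \<open>Continuous counterpart of the power mean inequality on one set \<open>B\<close>: the
  tangent plane at the ratio \<open>c\<close> of the two masses is integrated against the densities.
  Keeping the mass of the extrapolated Gaussian on the right lets bounds over a partition add
  up.\<close>

lemma gauss_powr_le_integral:
  assumes "\<sigma> > 0" "\<alpha> > 1" "B \<in> sets borel" "measure (gauss h \<sigma>) B > 0" "measure (gauss h' \<sigma>) B > 0"
  shows "measure (gauss h \<sigma>) B powr \<alpha> * measure (gauss h' \<sigma>) B powr (1 - \<alpha>)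
     \<le> exp (\<alpha> * (\<alpha> - 1) * ((h - h')\<^sup>2 / (2 * \<sigma>\<^sup>2))) * measure (gauss (\<alpha> * h + (1 - \<alpha>) * h') \<sigma>) B"
proof -
  let ?p = "measure (gauss h \<sigma>) B" and ?q = "measure (gauss h' \<sigma>) B"
  let ?E = "exp (\<alpha> * (\<alpha> - 1) * ((h - h')\<^sup>2 / (2 * \<sigma>\<^sup>2)))"
  define c where "c = ?p / ?q"
  have c: "c > 0" using assms by (simp add: c_def)
  have int: "integrable lborel (\<lambda>z. indicator B z * normal_density m \<sigma> z)" for m
    using assms integrable_mult_indicator[of B lborel "normal_density m \<sigma>"] by simp
  have "?p powr \<alpha> * ?q powr (1 - \<alpha>) = \<alpha> * c powr (\<alpha> - 1) * ?p - (\<alpha> - 1) * c powr \<alpha> * ?q"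
    unfolding c_def using assms by (intro powr_perspective_tangent_eq[symmetric])
  also have "\<dots> = (\<integral>z. \<alpha> * c powr (\<alpha> - 1) * (indicator B z * normal_density h \<sigma> z)
                     - (\<alpha> - 1) * c powr \<alpha> * (indicator B z * normal_density h' \<sigma> z) \<partial>lborel)"
    using assms int by (simp add: measure_gauss_eq_integral)
  also have "\<dots> \<le> (\<integral>z. ?E * (indicator B z * normal_density (\<alpha> * h + (1 - \<alpha>) * h') \<sigma> z) \<partial>lborel)"
  proof (rule integral_mono)
    fix z
    show "\<alpha> * c powr (\<alpha> - 1) * (indicator B z * normal_density h \<sigma> z)
            - (\<alpha> - 1) * c powr \<alpha> * (indicator B z * normal_density h' \<sigma> z)
        \<le> ?E * (indicator B z * normal_density (\<alpha> * h + (1 - \<alpha>) * h') \<sigma> z)"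
      using powr_perspective_tangent[OF \<open>\<alpha> > 1\<close> normal_density_pos[OF \<open>\<sigma> > 0\<close>] normal_density_pos[OF \<open>\<sigma> > 0\<close>] c, of h z h' z]
      by (auto simp: normal_density_powr_mult[OF \<open>\<sigma> > 0\<close>] split: split_indicator)
  qed (use int in auto)
  also have "\<dots> = ?E * measure (gauss (\<alpha> * h + (1 - \<alpha>) * h') \<sigma>) B"
    using assms by (simp add: measure_gauss_eq_integral)
  finally show ?thesis .
qed

section \<open>Threshold tests on Gaussians\<close>

lemma measure_gauss_compl:
  assumes "\<sigma> > 0"
  shows "measure (gauss \<mu> \<sigma>) {..<T} = 1 - measure (gauss \<mu> \<sigma>) {T..}"
proof -
  interpret prob_space "gauss \<mu> \<sigma>" using assms by (rule prob_space_normal_density)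
  have "{..<T} = space (gauss \<mu> \<sigma>) - {T..}" by auto
  then show ?thesis using prob_compl[of "{T..}"] by simp
qed

text \<open>The bound is applied to the two sides of the threshold; the corresponding masses of the
  extrapolated Gaussian sum to 1, which leaves only the exponential factor.\<close>

lemma renyi_bounded_gauss_tail:
  assumes "\<sigma> > 0"
  shows "renyi_bounded ((h - h')\<^sup>2 / (2 * \<sigma>\<^sup>2))
     (bernoulli_pmf (measure (gauss h \<sigma>) {T..})) (bernoulli_pmf (measure (gauss h' \<sigma>) {T..}))"
proof -
  \<comment> \<open>Both outcomes have positive probability for every mean, so the supports
    agree.\<close>
  have pos: "measure (gauss m \<sigma>) {T..} > 0" for m
    using assms by (intro measure_gauss_pos[of _ T "T + 1"]) auto
  have "measure (gauss m \<sigma>) {..<T} > 0" for m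
    using assms by (intro measure_gauss_pos[of _ "T - 1" T]) auto
  then have less1: "measure (gauss m \<sigma>) {T..} < 1" for m
    using measure_gauss_compl[OF assms, of m T] by (metis diff_gt_0_iff_gt)
  have set: "set_pmf (bernoulli_pmf (measure (gauss m \<sigma>) {T..})) = UNIV" for m
    using pos less1 by (intro set_pmf_bernoulli) auto
  have "(\<Sum>s\<in>UNIV. pmf (bernoulli_pmf (measure (gauss h \<sigma>) {T..})) s powr \<alpha> *
          pmf (bernoulli_pmf (measure (gauss h' \<sigma>) {T..})) s powr (1 - \<alpha>))
       \<le> exp (\<alpha> * (\<alpha> - 1) * ((h - h')\<^sup>2 / (2 * \<sigma>\<^sup>2)))" if \<alpha>: "\<alpha> > 1" for \<alpha>
  proof -
    let ?E = "exp (\<alpha> * (\<alpha> - 1) * ((h - h')\<^sup>2 / (2 * \<sigma>\<^sup>2)))"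
    let ?m = "\<alpha> * h + (1 - \<alpha>) * h'"
    have "measure (gauss h \<sigma>) {T..} powr \<alpha> * measure (gauss h' \<sigma>) {T..} powr (1 - \<alpha>) \<le> ?E * measure (gauss ?m \<sigma>) {T..}"
      using assms \<alpha> pos by (intro gauss_powr_le_integral) auto
    moreover have "(1 - measure (gauss h \<sigma>) {T..}) powr \<alpha> * (1 - measure (gauss h' \<sigma>) {T..}) powr (1 - \<alpha>)
        \<le> ?E * (1 - measure (gauss ?m \<sigma>) {T..})"
      unfolding measure_gauss_compl[OF assms, symmetric]
      using assms \<alpha> less1 by (intro gauss_powr_le_integral) (auto simp: measure_gauss_compl)
    ultimately show ?thesis
      using pos less1 by (simp add: UNIV_bool less_imp_le algebra_simps)
  qed
  then show ?thesis by (simp add: renyi_bounded_def set)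
qed

text \<open>\<open>Phi_inv\<close> is a definite description, so existence and uniqueness are both
  required. Absence of atoms, the limits of the distribution function and the intermediate value
  theorem give existence; positive mass of intervals gives uniqueness.\<close>

lemma Phi_Phi_inv:
  assumes "0 < p" "p < 1"
  shows "Phi (Phi_inv p) = p"
proof -
  interpret real_distribution "gauss 0 1"
    by (intro real_distribution.intro prob_space_normal_density real_distribution_axioms.intro) auto
  have Phi: "Phi = cdf (gauss 0 1)" by (auto simp: Phi_def cdf_def)
  have "measure (gauss 0 1) {x} = 0" for x
    by (subst measure_gauss_eq_integral) (auto intro!: integral_eq_zero_AE eventually_mono[OF AE_lborel_singleton[of x]])
  then have cont: "isCont Phi x" for x using isCont_cdf Phi by simp
  have strict: "Phi a < Phi b" if "a < b" for a b
  proof -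
    have "measure (gauss 0 1) {a<..b} > 0"
      using that by (intro measure_gauss_pos[of _ a b]) auto
    then show ?thesis using cdf_diff_eq[OF that] Phi by simp
  qed
  obtain a where a: "Phi a < p"
    using order_tendstoD(2)[OF cdf_lim_at_bot assms(1)] Phi by (auto simp: eventually_at_bot_linorder)
  obtain b where b: "Phi b > p"
    using order_tendstoD(1)[OF cdf_lim_at_top_prob assms(2)] Phi by (auto simp: eventually_at_top_linorder)
  have "a \<le> b" using a b strict[of b a] by (cases "a \<le> b") auto
  then obtain x where x: "Phi x = p"
    using IVT[of Phi a p b] a b cont by force
  then have "\<exists>!x. Phi x = p" using strict by (metis less_irrefl linorder_neqE_linordered_idom)
  then show ?thesis unfolding Phi_inv_def by (rule theI')
qed

text \<open>Standardisation, followed by dropping a null endpoint. The interval is open because an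
  item is withheld when its noisy weight is strictly below the threshold.\<close>

lemma Phi_eq_gauss:
  assumes "\<sigma> > 0"
  shows "measure (gauss h \<sigma>) {..<h + \<sigma> * x} = Phi x"
proof -
  have "measure (gauss 0 1) {z. h + \<sigma> * z \<in> {..<h + \<sigma> * x}} = measure (gauss h \<sigma>) {..<h + \<sigma> * x}"
    using assms measure_gauss_affine[of 1 \<sigma> "{..<h + \<sigma> * x}" 0 h] by simp
  moreover have "{z. h + \<sigma> * z \<in> {..<h + \<sigma> * x}} = {..<x}" using assms by auto
  moreover have "measure (gauss 0 1) {..<x} = measure (gauss 0 1) {..x}"
    unfolding measure_def
    by (rule arg_cong[where f = enn2real], rule emeasure_eq_AE)
       (auto simp: AE_density intro!: eventually_mono[OF AE_lborel_singleton[of x]])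
  ultimately show ?thesis by (simp add: Phi_def)
qed

section \<open>The Weighted Gaussian mechanism\<close>

lemma WG_sigma_pos: "\<rho> > 0 \<Longrightarrow> WG_sigma \<rho> > 0"
  by (simp add: WG_sigma_def)

lemma WG_release_prob_eq:
  assumes "\<rho> > 0"
  shows "WG_release_prob \<rho> T h = measure (gauss h (WG_sigma \<rho>)) {T..}"
  using measure_gauss_affine[OF WG_sigma_pos[OF assms], of 1 "{T..}" 0 h]
  by (simp add: WG_release_prob_def)

text \<open>The \<open>k\<close>-th entry of the maximum is the point below which a Gaussian of mean
  \<open>1 / sqrt (real k)\<close> has mass exactly \<open>(1 - \<delta>) powr (1 / real k)\<close>.
  Hence \<open>k\<close> independent items of this weight are all withheld with probability at least
  \<open>1 - \<delta>\<close>.\<close>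

lemma WG_threshold_tail:
  assumes "\<rho> > 0" "0 < \<delta>" "\<delta> < 1" "1 \<le> k" "k \<le> D0"
  shows "(1 - \<delta>) powr (1 / real k) \<le> 1 - WG_release_prob \<rho> (WG_threshold \<rho> \<delta> D0) (1 / sqrt (real k))"
proof -
  let ?\<sigma> = "WG_sigma \<rho>" and ?h = "1 / sqrt (real k)" and ?p = "(1 - \<delta>) powr (1 / real k)"
  let ?T = "WG_threshold \<rho> \<delta> D0"
  have \<sigma>: "?\<sigma> > 0" using assms by (simp add: WG_sigma_pos)
  interpret prob_space "gauss ?h ?\<sigma>" using \<sigma> by (rule prob_space_normal_density)
  have "?p < 1 powr (1 / real k)" using assms by (intro powr_less_mono2) auto
  then have "0 < ?p" "?p < 1" using assms by auto
  then have "?p = Phi (Phi_inv ?p)" by (simp add: Phi_Phi_inv)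
  also have "\<dots> = measure (gauss ?h ?\<sigma>) {..<?h + ?\<sigma> * Phi_inv ?p}"
    using \<sigma> by (simp add: Phi_eq_gauss)
  also have "\<dots> \<le> measure (gauss ?h ?\<sigma>) {..<?T}"
  proof (intro finite_measure_mono)
    have "?h + ?\<sigma> * Phi_inv ?p \<le> ?T"
      unfolding WG_threshold_def using assms by (intro Max_ge) auto
    then show "{..<?h + ?\<sigma> * Phi_inv ?p} \<subseteq> {..<?T}" by auto
  qed auto
  finally show ?thesis
    using assms \<sigma> by (simp add: WG_release_prob_eq measure_gauss_compl)
qed

section \<open>Independent release of the items of a finite support\<close>

definition release :: "('a \<Rightarrow> real) \<Rightarrow> 'a set \<Rightarrow> 'a set pmf" where
  "release p U = map_pmf (\<lambda>b. {u \<in> U. b u}) (Pi_pmf U False (\<lambda>u. bernoulli_pmf (p u)))"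

lemma pmf_release:
  assumes "finite U"
  shows "pmf (release p U) S = (if S \<subseteq> U then \<Prod>u\<in>U. pmf (bernoulli_pmf (p u)) (u \<in> S) else 0)"
proof -
  let ?P = "Pi_pmf U False (\<lambda>u. bernoulli_pmf (p u))"
  \<comment> \<open>The default \<open>False\<close> outside \<open>U\<close> turns the restricted
    comprehension into the injective map \<open>Collect\<close>.\<close>
  have "release p U = map_pmf Collect ?P"
    unfolding release_def
    using set_Pi_pmf_subset[OF assms, of False] by (intro map_pmf_cong) auto
  then have "pmf (release p U) S = pmf (map_pmf Collect ?P) (Collect (\<lambda>u. u \<in> S))" by simp
  also have "\<dots> = pmf ?P (\<lambda>u. u \<in> S)"
    by (rule pmf_map_inj') (auto simp: inj_def)
  also have "\<dots> = (if S \<subseteq> U then \<Prod>u\<in>U. pmf (bernoulli_pmf (p u)) (u \<in> S) else 0)"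
    using assms by (auto simp: pmf_Pi)
  finally show ?thesis .
qed

text \<open>An outcome inside \<open>U\<close> has the same factors over \<open>U\<close> in both
  laws; the larger support contributes in addition the probability that all of \<open>V - U\<close>
  is withheld.\<close>

lemma dominated_release_Un:
  assumes fin: "finite U" "finite V" and \<delta>: "0 < \<delta>" "\<delta> < 1"
    and p: "\<And>u. u \<in> V - U \<Longrightarrow> 0 \<le> p u \<and> p u \<le> 1 \<and> (1 - \<delta>) powr (1 / real (card V)) \<le> 1 - p u"
  shows "dominated \<delta> (release p U) (release p (U \<union> V))"
  unfolding dominated_def
proof
  fix S
  show "(1 - \<delta>) * pmf (release p U) S \<le> pmf (release p (U \<union> V)) S"
  proof (cases "S \<subseteq> U")
    case True
    let ?f = "\<lambda>u. pmf (bernoulli_pmf (p u)) (u \<in> S)"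
    have "1 - \<delta> \<le> ((1 - \<delta>) powr (1 / real (card V))) ^ card (V - U)"
    proof (cases "card V = 0")
      case True
      then show ?thesis using fin \<delta> by simp
    next
      case False
      \<comment> \<open>Only \<open>card (V - U)\<close> of the \<open>card V\<close> possible
        factors occur, and an exponent at most 1 does not decrease a base in
        \<open>(0, 1)\<close>.\<close>
      have "real (card (V - U)) / real (card V) \<le> 1"
        using False fin by (auto simp: divide_le_eq_1 card_mono)
      then have "(1 - \<delta>) powr 1 \<le> (1 - \<delta>) powr (real (card (V - U)) / real (card V))"
        using \<delta> by (intro powr_mono') auto
      then show ?thesis using \<delta> by (simp add: powr_power)
    qed
    also have "\<dots> = (\<Prod>u\<in>V - U. (1 - \<delta>) powr (1 / real (card V)))" by simp
    also have "\<dots> \<le> (\<Prod>u\<in>V - U. ?f u)"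
    proof (intro prod_mono conjI)
      fix u assume u: "u \<in> V - U"
      then have "u \<notin> S" using True by auto
      then show "(1 - \<delta>) powr (1 / real (card V)) \<le> ?f u" using p[OF u] by simp
    qed simp
    finally have "(1 - \<delta>) * (\<Prod>u\<in>U. ?f u) \<le> (\<Prod>u\<in>V - U. ?f u) * (\<Prod>u\<in>U. ?f u)"
      by (intro mult_right_mono prod_nonneg) auto
    also have "\<dots> = (\<Prod>u\<in>U \<union> V. ?f u)"
      using fin prod.union_disjoint[of U "V - U" ?f] by (simp add: mult.commute)
    finally show ?thesis using True fin by (simp add: pmf_release le_supI1)
  next
    case False
    then have "pmf (release p U) S = 0" using fin by (simp add: pmf_release)
    then show ?thesis by simp
  qed
qed

text \<open>The new weights on the old support \<open>U\<close> give the intermediate law: it has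
  the Renyi bound against the old release, and withholding all of \<open>V - U\<close> makes it
  dominated by the new one.\<close>

lemma approx_close_release:
  fixes H H' :: "'a \<Rightarrow> real"
  assumes fin: "finite U" "finite V" and V: "card V \<le> D0"
    and \<rho>: "\<rho> > 0" and \<delta>: "0 < \<delta>" "\<delta> < 1"
    and H': "\<And>u. H' u = H u + (if u \<in> V then 1 / sqrt (real (card V)) else 0)"
    and H0: "\<And>u. u \<notin> U \<Longrightarrow> H u = 0"
  defines "T \<equiv> WG_threshold \<rho> \<delta> D0"
  shows "approx_close \<rho> \<delta> (release (\<lambda>u. WG_release_prob \<rho> T (H u)) U)
           (release (\<lambda>u. WG_release_prob \<rho> T (H' u)) (U \<union> V))"
proof -
  let ?p = "\<lambda>u. WG_release_prob \<rho> T (H u)" and ?q = "\<lambda>u. WG_release_prob \<rho> T (H' u)"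
  let ?\<sigma> = "WG_sigma \<rho>"
  have \<sigma>: "?\<sigma> > 0" using \<rho> by (simp add: WG_sigma_pos)
  define e where "e u = (H u - H' u)\<^sup>2 / (2 * ?\<sigma>\<^sup>2)" for u
  \<comment> \<open>The squared shift is \<open>1 / card V\<close> and twice the variance is
    \<open>1 / \<rho>\<close>, so the cost is spread evenly over \<open>V\<close>.\<close>
  have e: "e u = (if u \<in> V then \<rho> / real (card V) else 0)" for u
    using \<rho> by (auto simp: e_def H' WG_sigma_def power_divide)
  have "(\<Sum>u\<in>U. e u) = (\<Sum>u\<in>U \<inter> V. \<rho> / real (card V))"
    unfolding e by (rule sum.inter_restrict[symmetric, OF fin(1)])
  also have "\<dots> = \<rho> * (real (card (U \<inter> V)) / real (card V))" by simp
  also have "\<dots> \<le> \<rho> * 1"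
    using \<rho> fin by (intro mult_left_mono) (auto simp: divide_le_eq_1 card_mono)
  finally have sum_e: "(\<Sum>u\<in>U. e u) \<le> \<rho>" by simp
  have "renyi_bounded (\<Sum>u\<in>U. e u) (release ?p U) (release ?q U)"
    unfolding release_def e_def WG_release_prob_eq[OF \<rho>]
    by (intro renyi_bounded_map renyi_bounded_Pi_pmf fin renyi_bounded_gauss_tail \<sigma>)
  moreover have "e u = (H' u - H u)\<^sup>2 / (2 * ?\<sigma>\<^sup>2)" for u
    by (simp add: e_def power2_commute)
  then have "renyi_bounded (\<Sum>u\<in>U. e u) (release ?q U) (release ?p U)"
    unfolding release_def WG_release_prob_eq[OF \<rho>]
    by (simp only:) (intro renyi_bounded_map renyi_bounded_Pi_pmf fin renyi_bounded_gauss_tail \<sigma>)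
  moreover have "dominated \<delta> (release ?q U) (release ?q (U \<union> V))"
  proof (rule dominated_release_Un[OF fin \<delta>])
    fix u assume u: "u \<in> V - U"
    then have "1 \<le> card V" using fin by (metis DiffD1 One_nat_def Suc_leI card_gt_0_iff empty_iff)
    \<comment> \<open>Outside \<open>U\<close> the old weight is 0, so the new weight is exactly
      that of the threshold bound with \<open>k = card V\<close>.\<close>
    then have "(1 - \<delta>) powr (1 / real (card V)) \<le> 1 - ?q u"
      using WG_threshold_tail[OF \<rho> \<delta> _ V] u H0[of u] by (simp add: H' T_def)
    moreover have "0 \<le> ?q u" by (simp add: WG_release_prob_def)
    moreover have "?q u \<le> 1"
      using prob_space.prob_le_1[OF prob_space_normal_density[OF \<sigma>]] by (simp add: WG_release_prob_def)
    ultimately show "0 \<le> ?q u \<and> ?q u \<le> 1 \<and> (1 - \<delta>) powr (1 / real (card V)) \<le> 1 - ?q u" by simp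
  qed
  moreover have "dominated \<delta> (release ?p U) (release ?p U)" using \<delta> by (simp add: dominated_refl)
  ultimately show ?thesis
    unfolding approx_close_def using renyi_bounded_mono[OF _ sum_e] by blast
qed

section \<open>Sampling the users one after another\<close>

primrec sample_users :: "nat \<Rightarrow> 'a list list \<Rightarrow> 'a set list pmf" where
  "sample_users D0 [] = return_pmf []"
| "sample_users D0 (W # x) =
     do { V \<leftarrow> sample_user D0 W; Vs \<leftarrow> sample_users D0 x; return_pmf (V # Vs) }"

lemma sample_users_append:
  "sample_users D0 (x @ y) =
     do { Vs \<leftarrow> sample_users D0 x; Us \<leftarrow> sample_users D0 y; return_pmf (Vs @ Us) }"
  by (induction x) (simp_all add: bind_assoc_pmf bind_return_pmf bind_return_pmf')

text \<open>A list of samples spares the renumbering of users behind an inserted one. Induction from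
  the end is used because appending a user adds one index and keeps the others.\<close>

lemma sample_users_eq_Pi_pmf:
  "map_pmf (\<lambda>f. map f [0..<length x]) (Pi_pmf {..<length x} {} (\<lambda>i. sample_user D0 (x ! i)))
     = sample_users D0 x"
proof (induction x rule: rev_induct)
  case Nil
  then show ?case by simp
next
  case (snoc W x)
  let ?n = "length x"
  have "Pi_pmf {..<?n} {} (\<lambda>i. sample_user D0 ((x @ [W]) ! i)) = Pi_pmf {..<?n} {} (\<lambda>i. sample_user D0 (x ! i))"
    by (intro Pi_pmf_cong) (auto simp: nth_append)
  then have "map_pmf (\<lambda>f. map f [0..<length (x @ [W])])
        (Pi_pmf {..<length (x @ [W])} {} (\<lambda>i. sample_user D0 ((x @ [W]) ! i)))
     = do { V \<leftarrow> sample_user D0 W; f \<leftarrow> Pi_pmf {..<?n} {} (\<lambda>i. sample_user D0 (x ! i));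
            return_pmf (map f [0..<?n] @ [V]) }"
    by (simp add: lessThan_Suc Pi_pmf_insert' map_bind_pmf fun_upd_def)
       (intro bind_pmf_cong refl, auto)
  \<comment> \<open>The product law draws the new coordinate first, the list draws it last;
    independent draws commute.\<close>
  also have "\<dots> = do { f \<leftarrow> Pi_pmf {..<?n} {} (\<lambda>i. sample_user D0 (x ! i)); V \<leftarrow> sample_user D0 W;
            return_pmf (map f [0..<?n] @ [V]) }"
    by (rule bind_commute_pmf)
  also have "\<dots> = do { Vs \<leftarrow> sample_users D0 x; V \<leftarrow> sample_user D0 W; return_pmf (Vs @ [V]) }"
    by (simp add: snoc.IH[symmetric] bind_map_pmf)
  also have "\<dots> = sample_users D0 (x @ [W])"
    by (simp add: sample_users_append bind_assoc_pmf bind_return_pmf)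
  finally show ?case .
qed

definition list_hist :: "'a set list \<Rightarrow> 'a \<Rightarrow> real" where
  "list_hist Vs u = (\<Sum>V\<leftarrow>Vs. if u \<in> V then 1 / sqrt (real (card V)) else 0)"

lemma list_hist_eq_WG_hist: "list_hist (map f [0..<N]) = WG_hist N f"
proof
  fix u
  have "list_hist (map f [0..<N]) u = (\<Sum>i\<in>{0..<N}. if u \<in> f i then 1 / sqrt (real (card (f i))) else 0)"
    by (simp add: list_hist_def comp_def interv_sum_list_conv_sum_set_nat)
  also have "\<dots> = WG_hist N f u"
    unfolding WG_hist_def by (simp add: sum.If_cases) (intro sum.cong, auto)
  finally show "list_hist (map f [0..<N]) u = WG_hist N f u" .
qed

lemma list_hist_outside: "u \<notin> \<Union>(set Vs) \<Longrightarrow> list_hist Vs u = 0"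
  by (induction Vs) (auto simp: list_hist_def)

lemma list_hist_insert:
  "list_hist (Vs @ V # Us) u = list_hist (Vs @ Us) u + (if u \<in> V then 1 / sqrt (real (card V)) else 0)"
  by (simp add: list_hist_def)

definition release_list :: "real \<Rightarrow> real \<Rightarrow> nat \<Rightarrow> 'a set list \<Rightarrow> 'a set pmf" where
  "release_list \<rho> \<delta> D0 Vs =
     release (\<lambda>u. WG_release_prob \<rho> (WG_threshold \<rho> \<delta> D0) (list_hist Vs u)) (\<Union>(set Vs))"

lemma WG_eq_sample_users: "WG \<rho> \<delta> D0 x = bind_pmf (sample_users D0 x) (release_list \<rho> \<delta> D0)"
proof -
  have "(\<Union>i<length x. f i) = \<Union>(set (map f [0..<length x]))" for f :: "nat \<Rightarrow> 'a set"
    by auto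
  then show ?thesis
    unfolding WG_def sample_users_eq_Pi_pmf[symmetric] bind_map_pmf release_list_def release_def
      list_hist_eq_WG_hist Let_def map_pmf_def[symmetric] by simp
qed

lemma sample_user_properties:
  shows set_pmf_sample_user: "set_pmf (sample_user D0 W) = {S. S \<subseteq> set W \<and> card S = min D0 (card (set W))}"
    and finite_set_pmf_sample_user: "finite (set_pmf (sample_user D0 W))"
proof -
  let ?A = "{S. S \<subseteq> set W \<and> card S = min D0 (card (set W))}"
  have fin: "finite ?A" by simp
  \<comment> \<open>A witness for nonemptiness, without which \<open>pmf_of_set\<close> is
    unspecified.\<close>
  obtain S where "S \<subseteq> set W" "card S = min D0 (card (set W))"
    using obtain_subset_with_card_n[of "min D0 (card (set W))" "set W"] by auto
  then have ne: "?A \<noteq> {}" by blast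
  show "set_pmf (sample_user D0 W) = ?A"
    unfolding sample_user_def by (rule set_pmf_of_set[OF ne fin])
  then show "finite (set_pmf (sample_user D0 W))" using fin by simp
qed

lemma finite_set_pmf_sample_users: "finite (set_pmf (sample_users D0 x))"
  by (induction x) (auto simp: finite_set_pmf_sample_user)

lemma finite_Union_sample_users: "Vs \<in> set_pmf (sample_users D0 x) \<Longrightarrow> finite (\<Union>(set Vs))"
proof (induction x arbitrary: Vs)
  case (Cons W x)
  then obtain V Us where "V \<subseteq> set W" "Us \<in> set_pmf (sample_users D0 x)" "Vs = V # Us"
    by (auto simp: set_pmf_sample_user)
  then show ?case using Cons.IH[of Us] finite_subset[of V "set W"] by simp
qed simp

lemma approx_close_WG:
  assumes "neighbors x x'" and \<rho>: "\<rho> > 0" and \<delta>: "0 < \<delta>" "\<delta> < 1"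
  shows "approx_close \<rho> \<delta> (WG \<rho> \<delta> D0 x) (WG \<rho> \<delta> D0 x')"
proof -
  obtain a W b where x: "x = a @ b" and x': "x' = a @ W # b"
    using assms(1) by (metis neighbors_def append_take_drop_id append_Cons append_Nil)
  \<comment> \<open>A draw of \<open>V\<close> whose value is ignored does not change the law, and
    gives both sides the same sampling prefix.\<close>
  have WGx: "WG \<rho> \<delta> D0 x = do { Vs \<leftarrow> sample_users D0 a; Us \<leftarrow> sample_users D0 b; V \<leftarrow> sample_user D0 W;
      release_list \<rho> \<delta> D0 (Vs @ Us) }"
    by (simp add: x WG_eq_sample_users sample_users_append bind_assoc_pmf bind_return_pmf)
  have WGx': "WG \<rho> \<delta> D0 x' = do { Vs \<leftarrow> sample_users D0 a; Us \<leftarrow> sample_users D0 b; V \<leftarrow> sample_user D0 W;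
      release_list \<rho> \<delta> D0 (Vs @ V # Us) }"
    unfolding x' WG_eq_sample_users sample_users_append sample_users.simps bind_assoc_pmf bind_return_pmf
    by (subst bind_commute_pmf) simp
  show ?thesis
    unfolding WGx WGx'
  proof (intro approx_close_bind_same finite_set_pmf_sample_users finite_set_pmf_sample_user)
    fix Vs Us V
    assume Vs: "Vs \<in> set_pmf (sample_users D0 a)" and Us: "Us \<in> set_pmf (sample_users D0 b)"
      and V: "V \<in> set_pmf (sample_user D0 W)"
    have fin: "finite (\<Union>(set (Vs @ Us)))"
      using finite_Union_sample_users[OF Vs] finite_Union_sample_users[OF Us] by simp
    have V: "finite V" "card V \<le> D0"
      using V by (auto simp: set_pmf_sample_user intro: finite_subset[OF _ finite_set])
    have "\<Union>(set (Vs @ V # Us)) = \<Union>(set (Vs @ Us)) \<union> V" by auto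
    then show "approx_close \<rho> \<delta> (release_list \<rho> \<delta> D0 (Vs @ Us)) (release_list \<rho> \<delta> D0 (Vs @ V # Us))"
      unfolding release_list_def
      using approx_close_release[OF fin V \<rho> \<delta>, of "list_hist (Vs @ V # Us)" "list_hist (Vs @ Us)"]
        list_hist_insert list_hist_outside by metis
  qed (use \<delta> in auto)
qed

section \<open>Composition over the iterations\<close>

text \<open>Deleting the same released items from every list must preserve adjacency, so that the
  next iteration again starts from neighbors.\<close>

lemma neighbors_map:
  assumes "neighbors x x'"
  shows "neighbors (map f x) (map f x')"
  using assms unfolding neighbors_def by (auto simp: take_map drop_map)

text \<open>Given a common release \<open>P\<close>, both runs delete it from all lists and extend
  \<open>S\<close> equally, so the induction hypothesis applies for each fixed \<open>P\<close> and
  adaptive composition adds the budgets.\<close>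

lemma approx_close_sips_run:
  assumes "neighbors x x'" "\<And>b. b \<in> set bs \<Longrightarrow> fst b > 0 \<and> 0 < snd b" "sum_list (map snd bs) < 1"
  shows "approx_close (sum_list (map fst bs)) (sum_list (map snd bs)) (sips_run D0 bs x S) (sips_run D0 bs x' S)"
  using assms
proof (induction bs arbitrary: x x' S)
  case Nil
  then show ?case by (simp add: approx_close_refl)
next
  case (Cons b bs)
  have "0 \<le> sum_list (map snd bs)"
    using Cons.prems(2) by (intro sum_list_nonneg) (auto intro: less_imp_le)
  moreover have b: "0 < fst b" "0 < snd b" using Cons.prems(2)[of b] by auto
  moreover have "snd b + sum_list (map snd bs) < 1" using Cons.prems(3) by simp
  moreover have "approx_close (sum_list (map fst bs)) (sum_list (map snd bs))
      (sips_run D0 bs (map (filter (\<lambda>u. u \<notin> P)) x) (S \<union> P))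
      (sips_run D0 bs (map (filter (\<lambda>u. u \<notin> P)) x') (S \<union> P))" for P
  proof (intro Cons.IH neighbors_map)
    show "sum_list (map snd bs) < 1" using Cons.prems(3) b by simp
  qed (use Cons.prems in auto)
  ultimately show ?case
    using Cons.prems(1) by (auto intro!: approx_close_bind approx_close_WG)
qed

section \<open>The geometric budget schedule\<close>

lemma sum_list_sips_budget:
  assumes "I \<ge> 1" "r > 0"
  shows "sum_list (map (fst \<circ> sips_budget \<rho> \<delta> I r) [0..<I]) = \<rho>"
    and "sum_list (map (snd \<circ> sips_budget \<rho> \<delta> I r) [0..<I]) = \<delta>"
proof -
  \<comment> \<open>The share of iteration \<open>i\<close> in both budgets; for
    \<open>r \<noteq> 1\<close> the shares are a normalised geometric series read backwards.\<close>
  define w where "w i = (if r = 1 then 1 / real I else r ^ (I - i - 1) * (1 - r) / (1 - r ^ I))" for i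
  have "(\<Sum>i<I. w i) = 1"
  proof (cases "r = 1")
    case True
    then show ?thesis using assms by (simp add: w_def)
  next
    case False
    have "(\<Sum>i<I. r ^ (I - i - 1)) = (\<Sum>i<I. r ^ i)"
      using sum.nat_diff_reindex[of "\<lambda>i. r ^ i" I] by simp
    moreover have "(\<Sum>i<I. w i) = (\<Sum>i<I. r ^ (I - i - 1)) * (1 - r) / (1 - r ^ I)"
      using False by (simp add: w_def sum_distrib_right sum_divide_distrib)
    ultimately have "(\<Sum>i<I. w i) = (\<Sum>i<I. r ^ i) * (1 - r) / (1 - r ^ I)"
      by (simp only:)
    moreover have "(\<Sum>i<I. r ^ i) * (1 - r) = 1 - r ^ I"
      by (simp add: one_diff_power_eq mult.commute)
    moreover have "r ^ I \<noteq> 1" using False assms power_eq_1_iff[of r I] by auto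
    ultimately show ?thesis by simp
  qed
  moreover have "fst (sips_budget \<rho> \<delta> I r i) = \<rho> * w i" "snd (sips_budget \<rho> \<delta> I r i) = \<delta> * w i" for i
    by (auto simp: sips_budget_def w_def)
  ultimately show "sum_list (map (fst \<circ> sips_budget \<rho> \<delta> I r) [0..<I]) = \<rho>"
    "sum_list (map (snd \<circ> sips_budget \<rho> \<delta> I r) [0..<I]) = \<delta>"
    by (simp_all add: interv_sum_list_conv_sum_set_nat atLeast0LessThan sum_distrib_left[symmetric] comp_def)
qed

lemma sips_budget_pos:
  assumes "\<rho> > 0" "\<delta> > 0" "I \<ge> 1" "r > 0"
  shows "fst (sips_budget \<rho> \<delta> I r i) > 0" "snd (sips_budget \<rho> \<delta> I r i) > 0"
proof -
  \<comment> \<open>Numerator and denominator have the same sign: positive for \<open>r < 1\<close>,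
    negative for \<open>r > 1\<close>.\<close>
  have "(1 - r) / (1 - r ^ I) > 0" if "r \<noteq> 1"
  proof (cases "r < 1")
    case True
    then show ?thesis using assms power_Suc_less_one[of r "I - 1"] by simp
  next
    case False
    then show ?thesis using that assms one_less_power[of r I] by (intro divide_neg_neg) auto
  qed
  then have "c * r ^ (I - i - 1) * ((1 - r) / (1 - r ^ I)) > 0" if "r \<noteq> 1" "c > 0" for c
    using that assms by (intro mult_pos_pos) auto
  then show "fst (sips_budget \<rho> \<delta> I r i) > 0" "snd (sips_budget \<rho> \<delta> I r i) > 0"
    using assms by (auto simp: sips_budget_def)
qed

theorem mainTheorem4:
  fixes \<rho> \<delta> r :: real and D0 I :: nat
  assumes "\<rho> > 0" and "0 < \<delta>" and "\<delta> < 1" and "I \<ge> 1" and "r > 0"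
  shows "approx_zCDP \<rho> \<delta> (DP_SIPS \<rho> \<delta> D0 I r :: 'a list list \<Rightarrow> 'a set pmf)"
proof (rule approx_zCDP_I)
  fix x x' :: "'a list list"
  assume nb: "neighbors x x'"
  let ?bs = "map (sips_budget \<rho> \<delta> I r) [0..<I]"
  have "approx_close (sum_list (map fst ?bs)) (sum_list (map snd ?bs)) (sips_run D0 ?bs x {}) (sips_run D0 ?bs x' {})"
    using assms nb sips_budget_pos sum_list_sips_budget
    by (intro approx_close_sips_run) auto
  then show "approx_close \<rho> \<delta> (DP_SIPS \<rho> \<delta> D0 I r x) (DP_SIPS \<rho> \<delta> D0 I r x')"
    using assms sum_list_sips_budget by (simp add: DP_SIPS_def)
qed (use assms in auto)

end
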